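(* Let $f:\mathbb{B}^n\to\mathbb{B}^N$ be holomorphic. Then $H_f$ is the trivial group if and only if $f$ is minimal.
   Context: $\mathbb{B}^k$ is the open unit ball in $\mathbb{C}^k$ and $\mathrm{Aut}(\mathbb{B}^k)$ is its group of holomorphic automorphisms. For holomorphic $f:\mathbb{B}^n\to\mathbb{B}^N$, $H_f=\{\psi\in\mathrm{Aut}(\mathbb{B}^N):\psi\circ f=f\}$. The map $f$ is minimal if its image lies in no affine linear subspace of $\mathbb{C}^N$ of dimension less than $N$. *)

theory Defs
  imports
    "HOL-Analysis.Analysis"
    "HOL-Algebra.Bij"
    "HOL-Algebra.Elementary_Groups"
begin

abbreviation unit_ball :: "(complex ^ 'k) set" where
  "unit_ball \<equiv> ball 0 1"

text \<open>Holomorphy in several variables (on an open set): Frechet differentiability with a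
  complex-linear derivative. The library's \<open>holomorphic_on\<close> covers only functions of one
  complex variable.\<close>

definition cholomorphic_on :: "(complex ^ 'n \<Rightarrow> complex ^ 'm) \<Rightarrow> (complex ^ 'n) set \<Rightarrow> bool"
  (infixl "cholomorphic'_on" 50) where
  "f cholomorphic_on U \<longleftrightarrow>
     (\<forall>z\<in>U. \<exists>f'. (f has_derivative f') (at z) \<and> Vector_Spaces.linear (*s) (*s) f')"

text \<open>As in \<open>BijGroup\<close>, automorphisms are extensional functions, so that equality of
  automorphisms is equality of maps on the ball.\<close>

definition Aut_ball :: "(complex ^ 'k \<Rightarrow> complex ^ 'k) set" where
  "Aut_ball = {\<psi> \<in> Bij unit_ball. \<psi> cholomorphic_on unit_ball \<and> inv_into unit_ball \<psi> cholomorphic_on unit_ball}"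

definition Aut_ball_group :: "(complex ^ 'k \<Rightarrow> complex ^ 'k) monoid" where
  "Aut_ball_group = (BijGroup unit_ball)\<lparr>carrier := Aut_ball\<rparr>"

definition H_set :: "(complex ^ 'n \<Rightarrow> complex ^ 'N) \<Rightarrow> (complex ^ 'N \<Rightarrow> complex ^ 'N) set" where
  "H_set f = {\<psi> \<in> Aut_ball. \<forall>z\<in>unit_ball. (\<psi> \<circ> f) z = f z}"

definition H_group :: "(complex ^ 'n \<Rightarrow> complex ^ 'N) \<Rightarrow> (complex ^ 'N \<Rightarrow> complex ^ 'N) monoid" where
  "H_group f = Aut_ball_group\<lparr>carrier := H_set f\<rparr>"

text \<open>Subspaces and dimension over the complex numbers; the library's \<open>affine\<close> is real-affine.\<close>

definition caffine_subspace :: "(complex ^ 'N) set \<Rightarrow> nat \<Rightarrow> bool" where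
  "caffine_subspace A d \<longleftrightarrow> (\<exists>a V. vec.subspace V \<and> vec.dim V = d \<and> A = (\<lambda>v. a + v) ` V)"

definition minimal_map :: "(complex ^ 'n \<Rightarrow> complex ^ 'N) \<Rightarrow> bool" where
  "minimal_map f \<longleftrightarrow> \<not> (\<exists>A d. caffine_subspace A d \<and> d < CARD('N) \<and> f ` unit_ball \<subseteq> A)"

lemma cholomorphic_on_cong:
  assumes "open U" "\<And>z. z \<in> U \<Longrightarrow> f z = g z" "f cholomorphic_on U"
  shows "g cholomorphic_on U"
  unfolding cholomorphic_on_def
proof
  fix z assume z: "z \<in> U"
  then obtain f' where "(f has_derivative f') (at z)" "Vector_Spaces.linear (*s) (*s) f'"
    using assms(3) unfolding cholomorphic_on_def by blast
  moreover from this(1) have "(g has_derivative f') (at z)"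
    by (rule has_derivative_transform_within_open[OF _ assms(1) z assms(2)])
  ultimately show "\<exists>g'. (g has_derivative g') (at z) \<and> Vector_Spaces.linear (*s) (*s) g'"
    by blast
qed

lemma cholomorphic_on_id: "(\<lambda>z. z) cholomorphic_on U"
  unfolding cholomorphic_on_def
  using has_derivative_ident vec.linear_ident by blast

lemma cholomorphic_on_compose:
  assumes "f cholomorphic_on U" "g cholomorphic_on V" "f \<in> U \<rightarrow> V"
  shows "(\<lambda>z. g (f z)) cholomorphic_on U"
  unfolding cholomorphic_on_def
proof
  fix z assume z: "z \<in> U"
  obtain f' where f: "(f has_derivative f') (at z)" "Vector_Spaces.linear (*s) (*s) f'"
    using assms(1) z unfolding cholomorphic_on_def by blast
  obtain g' where g: "(g has_derivative g') (at (f z))" "Vector_Spaces.linear (*s) (*s) g'"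
    using assms(2,3) z unfolding cholomorphic_on_def by blast
  have "((\<lambda>z. g (f z)) has_derivative (\<lambda>v. g' (f' v))) (at z)"
    using has_derivative_compose[OF f(1) g(1)] .
  moreover have "Vector_Spaces.linear (*s) (*s) (\<lambda>v. g' (f' v))"
    using Vector_Spaces.linear_compose[OF f(2) g(2)] by (simp add: comp_def)
  ultimately show "\<exists>h'. ((\<lambda>z. g (f z)) has_derivative h') (at z) \<and> Vector_Spaces.linear (*s) (*s) h'"
    by blast
qed

lemma subgroup_Aut_ball:
  "subgroup (Aut_ball :: (complex ^ 'k \<Rightarrow> complex ^ 'k) set) (BijGroup unit_ball)"
proof (rule subgroup.intro)
  show "(Aut_ball :: (complex ^ 'k \<Rightarrow> complex ^ 'k) set) \<subseteq> carrier (BijGroup unit_ball)"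
    by (auto simp: Aut_ball_def BijGroup_def)
next
  fix f g :: "complex ^ 'k \<Rightarrow> complex ^ 'k" assume fg: "f \<in> Aut_ball" "g \<in> Aut_ball"
  then have B: "f \<in> Bij unit_ball" "g \<in> Bij unit_ball"
    and h: "f cholomorphic_on unit_ball" "g cholomorphic_on unit_ball"
      "inv_into unit_ball f cholomorphic_on unit_ball" "inv_into unit_ball g cholomorphic_on unit_ball"
    by (auto simp: Aut_ball_def)
  have C: "compose unit_ball f g \<in> Bij unit_ball" using B by (rule compose_Bij)
  have 1: "compose unit_ball f g cholomorphic_on unit_ball"
    by (rule cholomorphic_on_cong[OF _ _ cholomorphic_on_compose[OF h(2,1) Bij_imp_funcset[OF B(2)]]])
       (auto simp: compose_def)
  have inv: "inv_into unit_ball g (inv_into unit_ball f z) = inv_into unit_ball (compose unit_ball f g) z"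
    if z: "z \<in> unit_ball" for z
  proof -
    let ?w = "inv_into unit_ball g (inv_into unit_ball f z)"
    have w: "?w \<in> unit_ball" using B z by (intro Bij_inv_into_mem)
    have bij: "bij_betw f unit_ball unit_ball" "bij_betw g unit_ball unit_ball"
      using B by (auto simp: Bij_def)
    have "f (g ?w) = z"
      unfolding bij_betw_inv_into_right[OF bij(2) Bij_inv_into_mem[OF B(1) z]]
      by (rule bij_betw_inv_into_right[OF bij(1) z])
    then have "compose unit_ball f g ?w = z"
      using w by (simp only: compose_eq)
    moreover have "inj_on (compose unit_ball f g) unit_ball"
      using C by (simp add: Bij_def bij_betw_def)
    ultimately have "inv_into unit_ball (compose unit_ball f g) z = ?w"
      by (rule inv_into_f_eq[OF _ w, rotated])
    then show ?thesis by (rule sym)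
  qed
  have "(\<lambda>z. inv_into unit_ball g (inv_into unit_ball f z)) cholomorphic_on unit_ball"
    by (rule cholomorphic_on_compose[OF h(3,4)]) (intro funcsetI Bij_inv_into_mem[OF B(1)])
  then have "inv_into unit_ball (compose unit_ball f g) cholomorphic_on unit_ball"
    by (rule cholomorphic_on_cong[rotated 2]) (use inv in auto)
  then show "f \<otimes>\<^bsub>BijGroup unit_ball\<^esub> g \<in> Aut_ball"
    using B C 1 by (simp add: BijGroup_def Aut_ball_def)
next
  have "(\<lambda>z\<in>unit_ball. z :: complex ^ 'k) cholomorphic_on unit_ball"
    by (rule cholomorphic_on_cong[OF _ _ cholomorphic_on_id]) auto
  moreover have "inv_into unit_ball (\<lambda>z\<in>unit_ball. z :: complex ^ 'k) cholomorphic_on unit_ball"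
    by (rule cholomorphic_on_cong[OF _ _ cholomorphic_on_id])
       (auto intro!: inv_into_f_eq[symmetric] simp: inj_on_def)
  ultimately show "\<one>\<^bsub>BijGroup unit_ball\<^esub> \<in> (Aut_ball :: (complex ^ 'k \<Rightarrow> _) set)"
    by (simp add: BijGroup_def Aut_ball_def id_Bij)
next
  fix f :: "complex ^ 'k \<Rightarrow> complex ^ 'k" assume "f \<in> Aut_ball"
  then have B: "f \<in> Bij unit_ball"
    and h: "f cholomorphic_on unit_ball" "inv_into unit_ball f cholomorphic_on unit_ball"
    by (auto simp: Aut_ball_def)
  let ?g = "\<lambda>z\<in>unit_ball. inv_into unit_ball f z"
  have g: "?g \<in> Bij unit_ball" using B by (rule restrict_inv_into_Bij)
  have 1: "?g cholomorphic_on unit_ball"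
    by (rule cholomorphic_on_cong[OF _ _ h(2)]) auto
  have "f z = inv_into unit_ball ?g z" if z: "z \<in> unit_ball" for z
  proof (rule inv_into_f_eq[symmetric])
    show "inj_on ?g unit_ball" using g by (simp add: Bij_def bij_betw_def)
    show fz: "f z \<in> unit_ball" using B z Bij_imp_funcset by blast
    show "?g (f z) = z"
      using B z fz bij_betw_inv_into_left[of f unit_ball unit_ball z] by (simp add: Bij_def)
  qed
  then have "inv_into unit_ball ?g cholomorphic_on unit_ball"
    by (rule cholomorphic_on_cong[OF _ _ h(1), rotated]) auto
  then show "inv\<^bsub>BijGroup unit_ball\<^esub> f \<in> Aut_ball"
    using B g 1 by (simp add: inv_BijGroup Aut_ball_def)
qed

lemma group_Aut_ball_group: "group (Aut_ball_group :: (complex ^ 'k \<Rightarrow> complex ^ 'k) monoid)"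
  unfolding Aut_ball_group_def
  by (rule group.subgroup_imp_group[OF group_BijGroup subgroup_Aut_ball])

lemma subgroup_H:
  assumes "f \<in> unit_ball \<rightarrow> unit_ball"
  shows "subgroup (H_set f) Aut_ball_group"
proof -
  interpret A: group Aut_ball_group by (rule group_Aut_ball_group)
  have car: "carrier Aut_ball_group = Aut_ball" by (simp add: Aut_ball_group_def)
  have f: "f z \<in> unit_ball" if "z \<in> unit_ball" for z using assms that by blast
  have sub: "Aut_ball \<subseteq> Bij unit_ball" by (auto simp: Aut_ball_def)
  show ?thesis
  proof (rule A.subgroupI)
    show "H_set f \<subseteq> carrier Aut_ball_group" by (auto simp: car H_set_def)
    have "\<one>\<^bsub>Aut_ball_group\<^esub> \<in> H_set f"
      using A.one_closed f unfolding car H_set_def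
      by (simp add: Aut_ball_group_def BijGroup_def del: mem_ball)
    then show "H_set f \<noteq> {}" by blast
  next
    fix a assume a: "a \<in> H_set f"
    then have aA: "a \<in> Aut_ball" and aB: "a \<in> Bij unit_ball" using sub by (auto simp: H_set_def)
    have eq: "inv\<^bsub>Aut_ball_group\<^esub> a = (\<lambda>z\<in>unit_ball. inv_into unit_ball a z)"
      using group.m_inv_consistent[OF group_BijGroup subgroup_Aut_ball aA] inv_BijGroup[OF aB]
      by (simp add: Aut_ball_group_def)
    have "inv_into unit_ball a (f z) = f z" if "z \<in> unit_ball" for z
      using a that f aB by (auto simp: H_set_def Bij_def bij_betw_def intro!: inv_into_f_eq)
    then have "\<forall>z\<in>unit_ball. (inv\<^bsub>Aut_ball_group\<^esub> a \<circ> f) z = f z"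
      using f by (simp add: eq del: mem_ball)
    then show "inv\<^bsub>Aut_ball_group\<^esub> a \<in> H_set f"
      using A.inv_closed[of a] aA unfolding car H_set_def by blast
  next
    fix a b assume ab: "a \<in> H_set f" "b \<in> H_set f"
    then have A: "a \<in> Aut_ball" "b \<in> Aut_ball" by (auto simp: H_set_def)
    have "\<forall>z\<in>unit_ball. (a \<otimes>\<^bsub>Aut_ball_group\<^esub> b \<circ> f) z = f z"
      using ab A sub f
      by (auto simp: Aut_ball_group_def BijGroup_def H_set_def compose_def subset_iff simp del: mem_ball)
    then show "a \<otimes>\<^bsub>Aut_ball_group\<^esub> b \<in> H_set f"
      using A.m_closed[of a b] A unfolding car H_set_def by blast
  qed
qed

end

theory Submission
  imports Defs "HOL-Complex_Analysis.Conformal_Mappings"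
begin

text \<open>
  The reflections of \<open>\<complex>\<^sup>N \<times> \<complex>\<close> that preserve the indefinite form
  \<open>\<bar>z\<bar>\<^sup>2 - \<bar>t\<bar>\<^sup>2\<close> act on the ball, seen as the set of negative lines \<open>[z : 1]\<close>, by
  involutive automorphisms \<open>ball_refl u c\<close>. Such a reflection fixes exactly the points of the
  ball on the complex hyperplane \<open>cinner z u = c\<close>. Both implications rest on these maps.

  If \<open>f\<close> is not minimal, then its image lies in a complex hyperplane; this hyperplane meets the
  ball, and the reflection in it is a nontrivial element of the group.

  Now let \<open>f\<close> be minimal and let \<open>\<psi>\<close> be an automorphism with \<open>\<psi> \<circ> f = f\<close>. A suitable
  reflection \<open>\<sigma>\<close> interchanges \<open>f 0\<close> and \<open>0\<close>, so \<open>F = \<sigma> \<circ> \<psi> \<circ> \<sigma>\<close> is a holomorphic self-map of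
  the ball that fixes \<open>0\<close>. The classical Schwarz lemma on complex discs through \<open>0\<close> shows that the
  fixed points of \<open>F\<close> are the fixed vectors of its derivative at \<open>0\<close>
  (\<open>fixed_point_iff_fixed_by_derivative\<close>), so they form a complex subspace \<open>V\<close> intersected with the
  ball. This set contains \<open>\<sigma> (f z)\<close> for all \<open>z\<close>. If \<open>V\<close> were proper, it would lie in a
  hyperplane; since \<open>\<sigma>\<close> is projective, the image of \<open>f\<close> would lie in a complex affine
  hyperplane as well (\<open>ball_refl_image_in_subspace_imp_hyperplane\<close>), against minimality. Hence
  \<open>V\<close> is everything, \<open>F\<close> is the identity on the ball, and so is \<open>\<psi>\<close>.
\<close>

section \<open>The Hermitian inner product\<close>

definition cinner :: "complex ^ 'k \<Rightarrow> complex ^ 'k \<Rightarrow> complex" where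
  "cinner x y = (\<Sum>i\<in>UNIV. x $ i * cnj (y $ i))"

lemma cinner_simps:
  "cinner (x + y) z = cinner x z + cinner y z"
  "cinner (x - y) z = cinner x z - cinner y z"
  "cinner (a *s x) z = a * cinner x z"
  "cinner x (y + z) = cinner x y + cinner x z"
  "cinner x (y - z) = cinner x y - cinner x z"
  "cinner x (a *s y) = cnj a * cinner x y"
  "cinner 0 z = 0" "cinner x 0 = 0"
  by (simp_all add: cinner_def algebra_simps sum.distrib sum_subtractf sum_distrib_left)

lemma cnj_cinner: "cnj (cinner x y) = cinner y x"
  by (simp add: cinner_def mult.commute)

lemma Re_cinner: "Re (cinner x y) = x \<bullet> y"
  by (simp add: cinner_def inner_vec_def inner_complex_def)

lemma cinner_self: "cinner x x = of_real ((norm x)\<^sup>2)"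
proof (rule complex_eqI)
  have "cnj (cinner x x) = cinner x x" by (rule cnj_cinner)
  then show "Im (cinner x x) = Im (of_real ((norm x)\<^sup>2))" by (simp add: complex_eq_iff)
qed (simp add: Re_cinner dot_square_norm)

lemma norm_vector_smult: "norm (a *s (x :: complex ^ 'k)) = cmod a * norm x"
proof -
  have "complex_of_real ((norm (a *s x))\<^sup>2) = (a * cnj a) * cinner x x"
    by (simp only: cinner_self[symmetric] cinner_simps mult_ac)
  also have "\<dots> = of_real ((cmod a * norm x)\<^sup>2)"
    by (simp only: power_mult_distrib of_real_mult complex_norm_square cinner_self)
  finally have "complex_of_real ((norm (a *s x))\<^sup>2) = of_real ((cmod a * norm x)\<^sup>2)" .
  then show ?thesis by (simp only: of_real_eq_iff power2_eq_iff_nonneg norm_ge_zero mult_nonneg_nonneg)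
qed

text \<open>Multiplying \<open>x\<close> by a phase makes the Hermitian product real and nonnegative, which reduces
  the claim to the real Cauchy-Schwarz inequality.\<close>

lemma norm_cinner_le: "cmod (cinner x y) \<le> norm x * norm y"
proof -
  define e where "e = cnj (sgn (cinner x y))"
  have "of_real (cmod (cinner x y)) = cinner (e *s x) y"
    using complex_norm_square[of "cinner x y"]
    by (cases "cinner x y = 0") (simp_all add: cinner_simps e_def sgn_eq field_simps power2_eq_square)
  then have "cmod (cinner x y) = (e *s x) \<bullet> y"
    by (metis Re_cinner Re_complex_of_real)
  also have "\<dots> \<le> norm (e *s x) * norm y" by (rule norm_cauchy_schwarz)
  also have "\<dots> \<le> norm x * norm y"
    by (intro mult_right_mono) (auto simp: norm_vector_smult e_def norm_sgn)
  finally show ?thesis .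
qed

lemma bounded_linear_cinner_left: "bounded_linear (\<lambda>x. cinner x y)"
proof (rule bounded_linear_intro)
  show "cinner (r *\<^sub>R x) y = r *\<^sub>R cinner x y" for r x
    by (simp add: cinner_def scaleR_right.sum)
  show "norm (cinner x y) \<le> norm x * norm y" for x by (rule norm_cinner_le)
qed (rule cinner_simps)

lemma bounded_bilinear_vector_smult:
  "bounded_bilinear (\<lambda>a (x :: complex ^ 'k). a *s x)"
proof
  show "\<exists>K. \<forall>a (x :: complex ^ 'k). norm (a *s x) \<le> norm a * norm x * K"
    by (rule exI[of _ 1]) (simp add: norm_vector_smult)
qed (simp_all add: vec_eq_iff algebra_simps)

text \<open>The equality case of Cauchy-Schwarz, that is, strict convexity of the ball: it turns control
  of one component of a vector into control of the whole vector.\<close>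

lemma eq_if_cinner_eq_norm:
  assumes "norm w \<le> norm z" "cinner w z = of_real ((norm z)\<^sup>2)"
  shows "w = z"
proof -
  have "w \<bullet> z = (norm z)\<^sup>2" using assms(2) by (metis Re_cinner Re_complex_of_real)
  moreover have "(norm w)\<^sup>2 \<le> (norm z)\<^sup>2" using assms(1) by (simp add: power_mono)
  ultimately have "(norm (w - z))\<^sup>2 \<le> 0"
    by (simp add: power2_norm_eq_inner inner_diff inner_commute)
  then show ?thesis by simp
qed

section \<open>Complex hyperplanes\<close>

text \<open>A real-orthogonal vector suffices: applying real orthogonality to both \<open>v\<close> and \<open>\<i> v\<close>
  annihilates the real and the imaginary part of the Hermitian product.\<close>

lemma csubspace_orthogonal_exists:
  fixes V :: "(complex ^ 'k) set"
  assumes "vec.subspace V" "V \<noteq> UNIV"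
  obtains w where "w \<noteq> 0" "\<And>v. v \<in> V \<Longrightarrow> cinner v w = 0"
proof -
  have scaleR: "r *\<^sub>R x = complex_of_real r *s x" for r and x :: "complex ^ 'k"
    by (simp add: vec_eq_iff complex_eq_iff)
  have "subspace V"
    using assms(1) unfolding subspace_def vec.subspace_def scaleR by blast
  then have "span V = V" by (simp add: span_eq_iff)
  then have "span V \<subset> span UNIV" using assms(2) by (simp add: \<open>span V = V\<close> psubset_eq)
  from orthogonal_to_subspace_exists_gen[OF this] obtain w
    where w: "w \<noteq> 0" "\<And>y. y \<in> span V \<Longrightarrow> orthogonal w y" by blast
  have re: "Re (cinner v w) = 0" if "v \<in> V" for v
    using w(2)[of v] that \<open>span V = V\<close> by (simp add: Re_cinner orthogonal_def inner_commute)
  have "cinner v w = 0" if "v \<in> V" for v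
    using re[OF that] re[OF vec.subspace_scale[OF assms(1) that, of \<i>]]
    by (simp add: cinner_simps complex_eq_iff)
  with w(1) show ?thesis by (rule that)
qed

lemma minimal_map_iff_no_hyperplane:
  fixes f :: "complex ^ 'n \<Rightarrow> complex ^ 'N"
  shows "minimal_map f \<longleftrightarrow> \<not> (\<exists>w c. w \<noteq> 0 \<and> (\<forall>z\<in>unit_ball. cinner (f z) w = c))"
proof -
  have "(\<exists>A d. caffine_subspace A d \<and> d < CARD('N) \<and> f ` unit_ball \<subseteq> A) \<longleftrightarrow>
      (\<exists>w c. w \<noteq> 0 \<and> (\<forall>z\<in>unit_ball. cinner (f z) w = c))"
  proof (intro iffI; elim exE conjE)
    fix A d assume A: "caffine_subspace A d" "d < CARD('N)" "f ` unit_ball \<subseteq> A"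
    then obtain a V where V: "vec.subspace V" "vec.dim V = d" "A = (\<lambda>v. a + v) ` V"
      unfolding caffine_subspace_def by blast
    have "V \<noteq> UNIV"
    proof
      assume "V = UNIV"
      then have "d = CARD('N)" using V(2) vec_dim_card[where 'a = complex and 'n = 'N] by simp
      with A(2) show False by simp
    qed
    then obtain w where w: "w \<noteq> 0" "\<And>v. v \<in> V \<Longrightarrow> cinner v w = 0"
      using csubspace_orthogonal_exists[OF V(1)] by blast
    have "cinner (f z) w = cinner a w" if z: "z \<in> unit_ball" for z
    proof -
      have "f z \<in> (\<lambda>v. a + v) ` V" using A(3) z unfolding V(3) by (meson image_subset_iff)
      then obtain v where "v \<in> V" "f z = a + v" by (elim imageE)
      then show ?thesis using w(2) by (simp add: cinner_simps)
    qed
    with w(1) show "\<exists>w c. w \<noteq> 0 \<and> (\<forall>z\<in>unit_ball. cinner (f z) w = c)" by metis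
  next
    fix w c assume w: "w \<noteq> 0" "\<forall>z\<in>unit_ball. cinner (f z) w = c"
    define V where "V = {v. cinner v w = 0}"
    have sub: "vec.subspace V"
      by (simp add: V_def vec.subspace_def cinner_simps)
    have "w \<notin> V" using w(1) by (simp add: V_def cinner_self)
    then have "vec.dim V \<noteq> CARD('N)"
      using vec.subspace_dim_equal[OF sub vec.subspace_UNIV subset_UNIV] vec_dim_card
      by (metis UNIV_I order_refl)
    moreover have "vec.dim V \<le> CARD('N)"
      using vec.dim_subset[OF subset_UNIV, of V] unfolding vec_dim_card .
    ultimately have "vec.dim V < CARD('N)" by simp
    moreover have "f ` unit_ball \<subseteq> (\<lambda>v. f 0 + v) ` V"
    proof (rule image_subsetI)
      fix z :: "complex ^ 'n" assume "z \<in> unit_ball"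
      then have "cinner (f z) w = c" "cinner (f 0) w = c" using w(2) by auto
      then have "f z - f 0 \<in> V" by (simp add: V_def cinner_simps)
      then show "f z \<in> (\<lambda>v. f 0 + v) ` V" by (rule rev_image_eqI) simp
    qed
    moreover have "caffine_subspace ((\<lambda>v. f 0 + v) ` V) (vec.dim V)"
      unfolding caffine_subspace_def using sub by blast
    ultimately show "\<exists>A d. caffine_subspace A d \<and> d < CARD('N) \<and> f ` unit_ball \<subseteq> A"
      by metis
  qed
  then show ?thesis unfolding minimal_map_def by (rule arg_cong)
qed

section \<open>Reflections of the ball\<close>

text \<open>Write \<open>p = (u, cnj c)\<close>, a vector on which the form \<open>\<bar>z\<bar>\<^sup>2 - \<bar>t\<bar>\<^sup>2\<close> takes the value
  \<open>\<bar>u\<bar>\<^sup>2 - \<bar>c\<bar>\<^sup>2\<close>. The reflection along \<open>p\<close> subtracts from \<open>(z, 1)\<close> the multiple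
  \<open>refl_coeff u c z\<close> of \<open>p\<close>; dividing by the last coordinate gives \<open>ball_refl u c z\<close>.\<close>

definition refl_coeff :: "complex ^ 'k \<Rightarrow> complex \<Rightarrow> complex ^ 'k \<Rightarrow> complex" where
  "refl_coeff u c z = 2 * (cinner z u - c) / of_real ((norm u)\<^sup>2 - (cmod c)\<^sup>2)"

definition ball_refl :: "complex ^ 'k \<Rightarrow> complex \<Rightarrow> complex ^ 'k \<Rightarrow> complex ^ 'k" where
  "ball_refl u c z =
     inverse (1 - refl_coeff u c z * cnj c) *s (z - refl_coeff u c z *s u)"

lemma reflection_normal_nonisotropic:
  assumes "cmod c < norm u"
  shows "complex_of_real ((norm u)\<^sup>2 - (cmod c)\<^sup>2) \<noteq> 0"
proof -
  have "(cmod c)\<^sup>2 < (norm u)\<^sup>2" using assms by (simp add: power_strict_mono)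
  then show ?thesis unfolding of_real_eq_0_iff by linarith
qed

text \<open>The reflection preserves the form. This is what makes it act on the ball, and it also keeps
  the denominator away from zero there.\<close>

lemma form_reflect:
  fixes u z :: "complex ^ 'k"
  assumes "cmod c < norm u"
  defines "k \<equiv> refl_coeff u c z"
  shows "(norm (z - k *s u))\<^sup>2 - (cmod (1 - k * cnj c))\<^sup>2 = (norm z)\<^sup>2 - 1"
proof -
  define d where "d = complex_of_real ((norm u)\<^sup>2 - (cmod c)\<^sup>2)"
  have "d \<noteq> 0" unfolding d_def by (rule reflection_normal_nonisotropic[OF assms(1)])
  have uu: "cinner u u = d + c * cnj c"
    unfolding d_def cinner_self of_real_diff complex_norm_square by simp
  define h where "h = cinner z u - c"
  have kd: "h = k * d / 2"
    using \<open>d \<noteq> 0\<close> by (simp add: k_def refl_coeff_def h_def d_def del: of_real_diff)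
  have d: "cnj d = d" by (simp add: d_def)
  have zu: "cinner z u = c + k * d / 2" by (simp add: h_def flip: kd)
  have uz: "cinner u z = cnj c + cnj k * d / 2"
    using arg_cong[OF zu, of cnj] by (simp add: cnj_cinner d)
  have "complex_of_real ((norm (z - k *s u))\<^sup>2 - (cmod (1 - k * cnj c))\<^sup>2)
      = cinner (z - k *s u) (z - k *s u) - (1 - k * cnj c) * cnj (1 - k * cnj c)"
    unfolding of_real_diff complex_norm_square cinner_self by simp
  also have "\<dots> = cinner z z - 1"
    unfolding cinner_simps zu uz uu by (simp add: field_simps)
  also have "\<dots> = of_real ((norm z)\<^sup>2 - 1)" by (simp add: cinner_self)
  finally show ?thesis by (simp only: of_real_eq_iff)
qed

lemma refl_denominator_nonzero:
  assumes "cmod c < norm u" "norm z < 1"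
  shows "1 - refl_coeff u c z * cnj c \<noteq> 0"
proof
  assume "1 - refl_coeff u c z * cnj c = 0"
  with form_reflect[OF assms(1), of z] have "(norm z)\<^sup>2 - 1 \<ge> 0"
    by (metis diff_zero norm_zero zero_le_power2 zero_power2)
  with assms(2) show False using power_less_one_iff[of "norm z" 2] by auto
qed

lemma ball_refl_in_ball:
  assumes "cmod c < norm u" "norm z < 1"
  shows "norm (ball_refl u c z) < 1"
proof -
  define D where "D = 1 - refl_coeff u c z * cnj c"
  have "(norm z)\<^sup>2 - 1 < 0" using assms(2) power_less_one_iff[of "norm z" 2] by auto
  then have "(norm (z - refl_coeff u c z *s u))\<^sup>2 < (cmod D)\<^sup>2"
    using form_reflect[OF assms(1), of z] by (simp add: D_def)
  then have "norm (z - refl_coeff u c z *s u) < cmod D"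
    by (rule power_less_imp_less_base) simp
  moreover have "0 < cmod D" using refl_denominator_nonzero[OF assms] by (simp add: D_def)
  ultimately show ?thesis
    unfolding ball_refl_def D_def[symmetric] norm_vector_smult norm_inverse by (simp add: field_simps)
qed

text \<open>A linear reflection is an involution. Passing to affine coordinates rescales the coefficient
  of the second reflection to \<open>- k / D\<close>, where \<open>D\<close> is the denominator of the first.\<close>

lemma ball_refl_involution:
  assumes "cmod c < norm u" "norm z < 1"
  shows "ball_refl u c (ball_refl u c z) = z"
proof -
  define k where "k = refl_coeff u c z"
  define D where "D = 1 - k * cnj c"
  define d where "d = complex_of_real ((norm u)\<^sup>2 - (cmod c)\<^sup>2)"
  have D: "D \<noteq> 0" using refl_denominator_nonzero[OF assms] by (simp add: D_def k_def)
  have "d \<noteq> 0" unfolding d_def by (rule reflection_normal_nonisotropic[OF assms(1)])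
  have uu: "cinner u u = d + c * cnj c"
    unfolding d_def cinner_self of_real_diff complex_norm_square by simp
  have zu: "cinner z u = c + k * d / 2"
    using \<open>d \<noteq> 0\<close>
    by (simp add: k_def refl_coeff_def d_def field_simps del: of_real_diff)
  have img: "ball_refl u c z = inverse D *s (z - k *s u)"
    by (simp add: ball_refl_def D_def k_def)
  have "cinner (ball_refl u c z) u - c = - k * d / (2 * D)"
    unfolding img cinner_simps zu uu using D by (simp add: field_simps) (simp add: D_def algebra_simps)
  then have k': "refl_coeff u c (ball_refl u c z) = - k / D"
    using \<open>d \<noteq> 0\<close> D unfolding refl_coeff_def d_def[symmetric] by simp
  have "1 - (- k / D) * cnj c = inverse D"
    using D by (simp add: field_simps) (simp add: D_def)
  then have "ball_refl u c (ball_refl u c z) = D *s (inverse D *s (z - k *s u) - (- k / D) *s u)"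
    unfolding ball_refl_def[of u c "ball_refl u c z"] k' by (simp add: img)
  also have "\<dots> = z" using D by (simp add: vec_eq_iff field_simps)
  finally show ?thesis .
qed

lemma ball_refl_cholomorphic:
  assumes "cmod c < norm u"
  shows "ball_refl u c cholomorphic_on unit_ball"
  unfolding cholomorphic_on_def
proof
  fix z :: "complex ^ 'a" assume "z \<in> unit_ball"
  define m where "m = 2 / complex_of_real ((norm u)\<^sup>2 - (cmod c)\<^sup>2)"
  define k where "k = refl_coeff u c"
  define D where "D z = 1 - k z * cnj c" for z
  have k: "k = (\<lambda>z. m * (cinner z u - c))"
    by (simp add: k_def m_def refl_coeff_def fun_eq_iff)
  have D: "D z \<noteq> 0"
    using refl_denominator_nonzero[OF assms, of z] \<open>z \<in> unit_ball\<close> by (simp add: D_def k_def)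
  have dk: "(k has_derivative (\<lambda>v. m * cinner v u)) (at z)"
    unfolding k
    by (auto intro!: derivative_eq_intros bounded_linear.has_derivative[OF bounded_linear_cinner_left])
  have dD: "((\<lambda>z. inverse (D z)) has_derivative
      (\<lambda>v. - (inverse (D z) * (- (m * cinner v u * cnj c)) * inverse (D z)))) (at z)"
    unfolding D_def
    by (rule derivative_eq_intros dk refl | use D in \<open>simp add: D_def\<close>)+
  have dN: "((\<lambda>z. z - k z *s u) has_derivative (\<lambda>v. v - (m * cinner v u) *s u)) (at z)"
    by (intro has_derivative_diff has_derivative_ident
        bounded_linear.has_derivative[OF bounded_bilinear.bounded_linear_left[OF bounded_bilinear_vector_smult]] dk)
  have "(ball_refl u c has_derivative
      (\<lambda>v. inverse (D z) *s (v - (m * cinner v u) *s u)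
          + (- (inverse (D z) * (- (m * cinner v u * cnj c)) * inverse (D z))) *s (z - k z *s u))) (at z)"
    using bounded_bilinear.FDERIV[OF bounded_bilinear_vector_smult dD dN]
    by (simp add: ball_refl_def[abs_def] D_def k_def)
  moreover have "Vector_Spaces.linear (*s) (*s)
      (\<lambda>v. p *s (v - (m * cinner v u) *s u) + (- (p * (- (m * cinner v u * q)) * p)) *s y)" for p q y
    unfolding Vector_Spaces.linear_iff
    by (intro conjI allI vec.vector_space_axioms)
       (simp_all add: vec_eq_iff cinner_simps algebra_simps)
  ultimately show "\<exists>f'. (ball_refl u c has_derivative f') (at z) \<and> Vector_Spaces.linear (*s) (*s) f'"
    by blast
qed

lemma ball_refl_fixes_hyperplane: "cinner z u = c \<Longrightarrow> ball_refl u c z = z"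
  by (simp add: ball_refl_def refl_coeff_def)

text \<open>A point off the hyperplane is moved along \<open>p\<close>; it could be fixed only if \<open>(z, 1)\<close> and
  \<open>p = (u, cnj c)\<close> were proportional, but the form is negative on the former and positive on the
  latter.\<close>

lemma ball_refl_fixed_imp_hyperplane:
  assumes "cmod c < norm u" "norm z < 1" "ball_refl u c z = z"
  shows "cinner z u = c"
proof (rule ccontr)
  define k where "k = refl_coeff u c z"
  assume "cinner z u \<noteq> c"
  then have "k \<noteq> 0"
    using reflection_normal_nonisotropic[OF assms(1)] by (simp add: k_def refl_coeff_def del: of_real_diff)
  have D: "1 - k * cnj c \<noteq> 0" using refl_denominator_nonzero[OF assms(1,2)] by (simp add: k_def)
  have "z - k *s u = (1 - k * cnj c) *s ball_refl u c z"
    using D by (simp add: ball_refl_def k_def vec_eq_iff)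
  then have "k *s u = k *s (cnj c *s z)" unfolding assms(3) by (simp add: vec.scale_left_diff_distrib)
  then have "u = cnj c *s z" by (rule vec.scale_left_imp_eq[OF \<open>k \<noteq> 0\<close>])
  then have "norm u = cmod c * norm z" by (simp add: norm_vector_smult)
  also have "\<dots> \<le> cmod c" using assms(2) by (simp add: mult_left_le)
  finally show False using assms(1) by simp
qed

text \<open>With \<open>s = sqrt (1 - \<bar>a\<bar>\<^sup>2)\<close> the vectors \<open>(a, 1)\<close> and \<open>(0, s)\<close> have the same form value and
  a real product, so the reflection along their difference \<open>(a, 1 - s)\<close> interchanges them.\<close>

lemma ball_refl_moves_to_0_exists:
  fixes a :: "complex ^ 'k"
  assumes "norm a < 1"
  obtains u c where "cmod c < norm u" "ball_refl u c a = 0"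
proof (cases "a = 0")
  case True
  \<comment> \<open>For \<open>a = 0\<close> the difference vanishes; any reflection in a hyperplane through \<open>0\<close> will do.\<close>
  have "ball_refl (axis undefined 1 :: complex ^ 'k) 0 a = 0"
    using True by (simp add: ball_refl_fixes_hyperplane cinner_simps)
  then show ?thesis by (rule that[rotated]) (simp add: norm_axis_1)
next
  case False
  define A where "A = (norm a)\<^sup>2"
  define s where "s = sqrt (1 - A)"
  have "A < 1" using assms power_less_one_iff[of "norm a" 2] by (auto simp: A_def)
  then have s: "s > 0" "s\<^sup>2 = 1 - A" by (simp_all add: s_def)
  have "A > 0" using False by (simp add: A_def)
  then have "s\<^sup>2 < 1\<^sup>2" using s(2) by simp
  then have "s < 1" by (rule power_less_imp_less_base) simp
  have "s * s < s * 1" using s(1) \<open>s < 1\<close> by (intro mult_strict_left_mono)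
  then have less: "(1 - s)\<^sup>2 < A" using s(2) by (simp add: power2_eq_square algebra_simps)
  then have lt: "1 - s < norm a" unfolding A_def by (rule power_less_imp_less_base) simp
  \<comment> \<open>The coefficient is \<open>1\<close>, so the numerator \<open>a - 1 * a\<close> of the reflected point vanishes.\<close>
  have eq: "2 * (A - (1 - s)) = A - (1 - s)\<^sup>2"
    using s(2) by (simp add: power2_eq_square algebra_simps)
  have cmod: "cmod (of_real (1 - s)) = 1 - s" using \<open>s < 1\<close> unfolding norm_of_real by simp
  have "2 * (cinner a a - of_real (1 - s)) = complex_of_real (A - (1 - s)\<^sup>2)"
    unfolding eq[symmetric] cinner_self A_def[symmetric] by simp
  moreover have "complex_of_real (A - (1 - s)\<^sup>2) \<noteq> 0"
    using less unfolding of_real_eq_0_iff by simp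
  ultimately have "refl_coeff a (of_real (1 - s)) a = 1"
    unfolding refl_coeff_def cmod A_def[symmetric] by (simp only: divide_self not_False_eq_True)
  then have "ball_refl a (of_real (1 - s)) a = 0" by (simp add: ball_refl_def)
  moreover have "cmod (of_real (1 - s)) < norm a" using lt unfolding cmod .
  ultimately show ?thesis using that by blast
qed

lemma ball_refl_in_Aut_ball:
  fixes u :: "complex ^ 'k"
  assumes "cmod c < norm u"
  shows "restrict (ball_refl u c) unit_ball \<in> Aut_ball"
proof -
  let ?r = "restrict (ball_refl u c) unit_ball"
  have ball: "ball_refl u c z \<in> unit_ball" if "z \<in> unit_ball" for z
    using ball_refl_in_ball[OF assms] that by simp
  have inv: "ball_refl u c (ball_refl u c z) = z" if "z \<in> unit_ball" for z
    using ball_refl_involution[OF assms] that by simp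
  have bij: "bij_betw ?r unit_ball unit_ball"
    by (rule bij_betw_byWitness[where f' = "ball_refl u c"]) (use ball inv in auto)
  have "inv_into unit_ball ?r z = ball_refl u c z" if "z \<in> unit_ball" for z
    by (rule inv_into_f_eq) (use bij ball inv that in \<open>auto simp: bij_betw_def\<close>)
  then have "inv_into unit_ball ?r cholomorphic_on unit_ball"
    by (intro cholomorphic_on_cong[OF _ _ ball_refl_cholomorphic[OF assms]]) auto
  moreover have "?r cholomorphic_on unit_ball"
    by (intro cholomorphic_on_cong[OF _ _ ball_refl_cholomorphic[OF assms]]) auto
  ultimately show ?thesis using bij by (simp add: Aut_ball_def Bij_def)
qed

section \<open>Fixed points of holomorphic self-maps of the ball\<close>

text \<open>Restricting to a complex line and projecting to a vector reduces questions about maps of the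
  ball to functions of one complex variable.\<close>

lemma slice_has_field_derivative:
  fixes F :: "complex ^ 'n \<Rightarrow> complex ^ 'm"
  assumes F: "(F has_derivative F') (at (t *s p))" "Vector_Spaces.linear (*s) (*s) F'"
  shows "((\<lambda>t. cinner (F (t *s p)) v) has_field_derivative cinner (F' p) v) (at t)"
proof -
  have "((\<lambda>t. t *s p) has_derivative (\<lambda>s. s *s p)) (at t)"
    by (rule bounded_linear_imp_has_derivative)
       (rule bounded_bilinear.bounded_linear_left[OF bounded_bilinear_vector_smult])
  from has_derivative_compose[OF this F(1)]
  have "((\<lambda>t. cinner (F (t *s p)) v) has_derivative (\<lambda>s. cinner (F' (s *s p)) v)) (at t)"
    by (rule bounded_linear.has_derivative[OF bounded_linear_cinner_left])
  moreover have "F' (s *s p) = s *s F' p" for s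
    using F(2) unfolding Vector_Spaces.linear_iff by blast
  ultimately show ?thesis
    by (simp add: has_field_derivative_def cinner_simps mult.commute[of _ "cinner (F' p) v"] lambda_zero)
qed

context
  fixes F :: "complex ^ 'k \<Rightarrow> complex ^ 'k"
  assumes hol: "F cholomorphic_on unit_ball" and self: "F \<in> unit_ball \<rightarrow> unit_ball"
    and zero: "F 0 = 0"
begin

lemma slice_schwarz:
  assumes "norm p = 1" "norm v \<le> 1"
  defines "g \<equiv> \<lambda>t. cinner (F (t *s p)) v"
  shows "g holomorphic_on ball 0 1" "g 0 = 0" "\<And>t. cmod t < 1 \<Longrightarrow> cmod (g t) < 1"
proof -
  have inball: "t *s p \<in> unit_ball" if "cmod t < 1" for t
    using that assms(1) by (simp add: norm_vector_smult)
  show "g holomorphic_on ball 0 1"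
  proof (rule holomorphic_onI)
    fix t :: complex assume "t \<in> ball 0 1"
    then have "t *s p \<in> unit_ball" by (intro inball) simp
    then obtain F' where "(F has_derivative F') (at (t *s p))" "Vector_Spaces.linear (*s) (*s) F'"
      using hol unfolding cholomorphic_on_def by blast
    then have "(g has_field_derivative cinner (F' p) v) (at t)"
      unfolding g_def by (rule slice_has_field_derivative)
    then show "g field_differentiable at t within ball 0 1"
      using field_differentiable_at_within field_differentiable_def by blast
  qed
  show "g 0 = 0" by (simp add: g_def zero cinner_simps)
  show "cmod (g t) < 1" if "cmod t < 1" for t
  proof -
    have "cmod (g t) \<le> norm (F (t *s p)) * norm v" unfolding g_def by (rule norm_cinner_le)
    also have "\<dots> \<le> norm (F (t *s p))" using assms(2) by (simp add: mult_left_le)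
    also have "\<dots> < 1" using funcset_mem[OF self inball[OF that]] by simp
    finally show ?thesis .
  qed
qed

text \<open>The one-variable Schwarz lemma, applied to the component of \<open>F\<close> in the direction of its own
  value at the point in question, bounds the whole norm.\<close>

lemma ball_schwarz:
  assumes "norm p = 1" "cmod t < 1"
  shows "norm (F (t *s p)) \<le> cmod t"
proof (cases "F (t *s p) = 0")
  case False
  define v where "v = complex_of_real (inverse (norm (F (t *s p)))) *s F (t *s p)"
  have "norm v \<le> 1" using False by (simp add: v_def norm_vector_smult norm_inverse)
  from Schwarz_Lemma(1)[OF slice_schwarz[OF assms(1) this] assms(2)]
  have "cmod (cinner (F (t *s p)) v) \<le> cmod t" .
  moreover have "cinner (F (t *s p)) v = of_real (norm (F (t *s p)))"
    using False by (simp add: v_def cinner_simps cinner_self power2_eq_square)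
  ultimately show ?thesis by simp
qed simp

text \<open>If the component of \<open>F (t p)\<close> along \<open>p\<close> is already \<open>t\<close>, the bound \<open>\<bar>F (t p)\<bar> \<le> \<bar>t\<bar>\<close> leaves no
  room for any other component.\<close>

lemma fixes_disc_if_slice_eq_id:
  assumes p: "norm p = 1"
    and slice: "\<And>t. cmod t < 1 \<Longrightarrow> cinner (F (t *s p)) p = t" and t: "cmod t < 1"
  shows "F (t *s p) = t *s p"
proof (rule eq_if_cinner_eq_norm)
  show "norm (F (t *s p)) \<le> norm (t *s p)"
    using ball_schwarz[OF p t] by (simp add: norm_vector_smult p)
  have "cinner (F (t *s p)) (t *s p) = t * cnj t"
    using slice[OF t] by (simp add: cinner_simps mult.commute)
  then show "cinner (F (t *s p)) (t *s p) = of_real ((norm (t *s p))\<^sup>2)"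
    by (simp only: norm_vector_smult p mult_1_right complex_norm_square)
qed

text \<open>Let \<open>p\<close> be the unit vector in the direction of \<open>z\<close> and consider the slice
  \<open>g t = cinner (F (t p)) p\<close>. A fixed point \<open>z = r p\<close> gives \<open>g r = r\<close>, a fixed vector of the
  derivative gives \<open>g' 0 = 1\<close>. Either one is an equality case of the Schwarz lemma and forces \<open>g\<close>
  to be the identity, so \<open>F\<close> fixes the whole disc of multiples of \<open>p\<close>. This disc contains \<open>z\<close>,
  and differentiating along it shows that the derivative fixes \<open>p\<close>.\<close>

lemma fixed_point_iff_fixed_by_derivative:
  assumes L: "(F has_derivative L) (at 0)" "Vector_Spaces.linear (*s) (*s) L"
    and z: "norm z < 1"
  shows "F z = z \<longleftrightarrow> L z = z"
proof (cases "z = 0")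
  case True
  have "L 0 = 0" using L(1) by (metis has_derivative_bounded_linear linear_simps(3))
  with True zero show ?thesis by simp
next
  case False
  define r where "r = complex_of_real (norm z)"
  define p where "p = inverse r *s z"
  have r: "r \<noteq> 0" "cmod r < 1" using False z by (simp_all add: r_def)
  have p: "norm p = 1" using False by (simp add: p_def norm_vector_smult norm_inverse r_def)
  have z_eq: "z = r *s p" using r by (simp add: p_def)
  have Lscale: "L (s *s x) = s *s L x" for s x
    using L(2) unfolding Vector_Spaces.linear_iff by blast
  define g where "g = (\<lambda>t. cinner (F (t *s p)) p)"
  have g: "g holomorphic_on ball 0 1" "g 0 = 0" "\<And>t. cmod t < 1 \<Longrightarrow> cmod (g t) < 1"
    using slice_schwarz[OF p, of p] p by (simp_all add: g_def)
  have g': "(g has_field_derivative cinner (L p) p) (at 0)"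
    unfolding g_def by (rule slice_has_field_derivative) (use L in simp_all)
  have pp: "cinner p p = 1" by (simp add: cinner_self p)
  have disc: "F (t *s p) = t *s p"
    if "F z = z \<or> L z = z" "cmod t < 1" for t
  proof (rule fixes_disc_if_slice_eq_id[OF p _ that(2)])
    have eq: "g r = r \<or> cinner (L p) p = 1"
      using that(1)
    proof
      assume "F z = z"
      then have "g r = r" by (simp add: g_def cinner_simps pp flip: z_eq) (simp add: z_eq cinner_simps pp)
      then show ?thesis ..
    next
      assume "L z = z"
      then have "L p = p" unfolding p_def Lscale by simp
      then show ?thesis by (simp add: pp)
    qed
    then have "(\<exists>t. cmod t < 1 \<and> t \<noteq> 0 \<and> cmod (g t) = cmod t) \<or> cmod (deriv g 0) = 1"
      using r DERIV_imp_deriv[OF g'] by (metis norm_one)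
    from Schwarz_Lemma(3)[OF g r(2) this]
    obtain \<alpha> where \<alpha>: "\<And>t. cmod t < 1 \<Longrightarrow> g t = \<alpha> * t" by blast
    have "((\<lambda>t. \<alpha> * t) has_field_derivative \<alpha>) (at 0)"
      by (auto intro!: derivative_eq_intros)
    then have "(g has_field_derivative \<alpha>) (at 0)"
      by (rule has_field_derivative_transform_within_open[of _ _ _ "ball 0 1"]) (auto simp: \<alpha>)
    then have "cinner (L p) p = \<alpha>" using g' by (rule DERIV_unique[rotated])
    with eq r \<alpha>[of r] have "\<alpha> = 1" by auto
    then show "cinner (F (t *s p)) p = t" if "cmod t < 1" for t
      using \<alpha>[OF that] by (simp add: g_def)
  qed
  show ?thesis
  proof
    assume "L z = z"
    then show "F z = z" using disc r(2) z_eq by metis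
  next
    assume Fz: "F z = z"
    have "bounded_linear (\<lambda>t. t *s p)"
      by (rule bounded_bilinear.bounded_linear_left[OF bounded_bilinear_vector_smult])
    then have lin: "((\<lambda>t. t *s p) has_derivative (\<lambda>t. t *s p)) (at 0)"
      by (rule bounded_linear_imp_has_derivative)
    have "((\<lambda>t. F (t *s p)) has_derivative (\<lambda>t. L (t *s p))) (at 0)"
      by (rule has_derivative_compose[OF lin]) (use L(1) in simp)
    then have "((\<lambda>t. t *s p) has_derivative (\<lambda>t. L (t *s p))) (at 0)"
      by (rule has_derivative_transform_within_open[of _ _ _ _ "ball 0 1"]) (use disc Fz in auto)
    then have "(\<lambda>t. L (t *s p)) = (\<lambda>t. t *s p)" using lin by (rule has_derivative_unique)
    then show "L z = z" unfolding z_eq by (rule fun_cong)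
  qed
qed

end

section \<open>The isotropy group of a holomorphic map\<close>

text \<open>A reflection is projective, so after clearing the denominator a linear equation for its value
  becomes an affine equation \<open>cinner z w' = c'\<close>. The normal \<open>w'\<close> cannot vanish: that would force
  \<open>w\<close> to be a multiple of \<open>u\<close> and \<open>\<bar>u\<bar>\<^sup>2 - \<bar>c\<bar>\<^sup>2 = 2 \<bar>u\<bar>\<^sup>2\<close>, hence \<open>u = 0\<close>.\<close>

lemma ball_refl_image_in_subspace_imp_hyperplane:
  fixes u w :: "complex ^ 'k"
  assumes "cmod c < norm u" "w \<noteq> 0"
  obtains w' c' where "w' \<noteq> 0"
    "\<And>z. norm z < 1 \<Longrightarrow> cinner (ball_refl u c z) w = 0 \<Longrightarrow> cinner z w' = c'"
proof -
  define d where "d = (norm u)\<^sup>2 - (cmod c)\<^sup>2"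
  have d0: "complex_of_real d \<noteq> 0" unfolding d_def by (rule reflection_normal_nonisotropic[OF assms(1)])
  define b where "b = 2 * cinner u w / of_real d"
  define w' where "w' = w - cnj b *s u"
  have "w' \<noteq> 0"
  proof
    assume "w' = 0"
    then have w: "w = cnj b *s u" by (simp add: w'_def)
    with assms(2) have "b \<noteq> 0" by auto
    have "b * of_real d = 2 * cinner u w" using d0 by (simp add: b_def)
    also have "\<dots> = 2 * (b * of_real ((norm u)\<^sup>2))" by (simp add: w cinner_simps cinner_self)
    finally have "complex_of_real d = of_real (2 * (norm u)\<^sup>2)" using \<open>b \<noteq> 0\<close> by simp
    then have "d = 2 * (norm u)\<^sup>2" by (simp only: of_real_eq_iff)
    then have "(norm u)\<^sup>2 + (cmod c)\<^sup>2 = 0" unfolding d_def by linarith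
    then have "u = 0" unfolding sum_power2_eq_zero_iff by simp
    with assms(1) show False by simp
  qed
  moreover have "cinner z w' = - b * c"
    if z: "norm z < 1" "cinner (ball_refl u c z) w = 0" for z
  proof -
    have "cinner z w - refl_coeff u c z * cinner u w = 0"
      using z(2) refl_denominator_nonzero[OF assms(1) z(1)] by (simp add: ball_refl_def cinner_simps)
    moreover have "refl_coeff u c z * cinner u w = b * (cinner z u - c)"
      by (simp add: refl_coeff_def b_def d_def)
    ultimately show ?thesis by (simp add: w'_def cinner_simps algebra_simps)
  qed
  ultimately show ?thesis using that by blast
qed

text \<open>The reflection in a hyperplane containing the image is the required element. It is an
  automorphism of the ball because the hyperplane passes through the interior point \<open>f 0\<close>.\<close>

lemma nontrivial_isotropy_if_not_minimal:
  fixes f :: "complex ^ 'n \<Rightarrow> complex ^ 'N"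
  assumes f: "f \<in> unit_ball \<rightarrow> unit_ball" and "\<not> minimal_map f"
  obtains \<psi> where "\<psi> \<in> H_set f" "\<psi> \<noteq> (\<lambda>z\<in>unit_ball. z)"
proof -
  obtain u c where u: "u \<noteq> 0" and fu: "\<And>z. z \<in> unit_ball \<Longrightarrow> cinner (f z) u = c"
    using assms(2) unfolding minimal_map_iff_no_hyperplane by blast
  have fball: "f z \<in> unit_ball" if "z \<in> unit_ball" for z using f that by (rule funcset_mem)
  have "cmod c \<le> norm (f 0) * norm u" using fu[of 0] norm_cinner_le[of "f 0" u] by simp
  also have "\<dots> < norm u" using fball[of 0] u by simp
  finally have c: "cmod c < norm u" .
  let ?\<psi> = "restrict (ball_refl u c) unit_ball"
  have "?\<psi> \<in> H_set f"
    unfolding H_set_def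
    using ball_refl_in_Aut_ball[OF c] fball ball_refl_fixes_hyperplane[OF fu]
    by (simp del: mem_ball mem_ball_0)
  moreover have "?\<psi> \<noteq> (\<lambda>z\<in>unit_ball. z)"
  proof
    assume id: "?\<psi> = (\<lambda>z\<in>unit_ball. z)"
    have on: "cinner z u = c" if z: "norm z < 1" for z
      using fun_cong[OF id, of z] z by (intro ball_refl_fixed_imp_hyperplane[OF c]) simp_all
    \<comment> \<open>The hyperplane would contain the ball, in particular \<open>0\<close> and a multiple of its normal.\<close>
    let ?z = "complex_of_real (inverse (2 * norm u)) *s u"
    have "norm ?z < 1" using u by (simp add: norm_vector_smult norm_mult norm_inverse)
    then have "cinner ?z u = cinner 0 u" using on by simp
    then show False using u by (simp add: cinner_simps cinner_self)
  qed
  ultimately show ?thesis by (rule that)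
qed

text \<open>Conjugation by a reflection moves the fixed point \<open>f 0\<close> of \<open>\<psi>\<close> to the origin, where the
  fixed point set is linear.\<close>

lemma isotropy_trivial_if_minimal:
  fixes f :: "complex ^ 'n \<Rightarrow> complex ^ 'N"
  assumes f: "f \<in> unit_ball \<rightarrow> unit_ball" and min: "minimal_map f" and \<psi>: "\<psi> \<in> H_set f"
  shows "\<psi> = (\<lambda>z\<in>unit_ball. z)"
proof -
  have fball: "norm (f z) < 1" if "norm z < 1" for z using funcset_mem[OF f, of z] that by simp
  have bij: "\<psi> \<in> Bij unit_ball" and hol: "\<psi> cholomorphic_on unit_ball"
    and fixes_image: "\<And>z. norm z < 1 \<Longrightarrow> \<psi> (f z) = f z"
    using \<psi> by (auto simp: H_set_def Aut_ball_def)
  have self: "\<psi> \<in> unit_ball \<rightarrow> unit_ball" using bij by (rule Bij_imp_funcset)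
  have "norm (f 0) < 1" by (rule fball) simp
  from ball_refl_moves_to_0_exists[OF this] obtain u c
    where c: "cmod c < norm u" and to0: "ball_refl u c (f 0) = 0" by blast
  let ?\<sigma> = "ball_refl u c"
  note inv = ball_refl_involution[OF c]
  have \<sigma>: "?\<sigma> \<in> unit_ball \<rightarrow> unit_ball" using ball_refl_in_ball[OF c] by auto
  define F where "F z = ?\<sigma> (\<psi> (?\<sigma> z))" for z
  have F_hol: "F cholomorphic_on unit_ball"
    unfolding F_def
    by (rule cholomorphic_on_compose[OF cholomorphic_on_compose[OF ball_refl_cholomorphic[OF c] hol \<sigma>]
          ball_refl_cholomorphic[OF c]]) (use self \<sigma> in blast)
  have F_self: "F \<in> unit_ball \<rightarrow> unit_ball"
    unfolding F_def using self \<sigma> by blast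
  have F_fix: "F (?\<sigma> (f z)) = ?\<sigma> (f z)" if "norm z < 1" for z
    using that by (simp add: F_def inv fball fixes_image)
  have F_0: "F 0 = 0" using F_fix[of 0] by (simp add: to0)
  have "0 \<in> (unit_ball :: (complex ^ 'N) set)" by simp
  then obtain L where L: "(F has_derivative L) (at 0)" "Vector_Spaces.linear (*s) (*s) L"
    using F_hol unfolding cholomorphic_on_def by blast
  note fixed_iff = fixed_point_iff_fixed_by_derivative[OF F_hol F_self F_0 L]
  define V where "V = {v. L v = v}"
  have "L (x + y) = L x + L y" "L (a *s x) = a *s L x" for x y a
    using L(2) unfolding Vector_Spaces.linear_iff by blast+
  moreover have "L 0 = 0" using fixed_iff[of 0] F_0 by simp
  ultimately have sub: "vec.subspace V"
    unfolding V_def vec.subspace_def by simp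
  have "V = UNIV"
  proof (rule ccontr)
    assume "V \<noteq> UNIV"
    then obtain w where w: "w \<noteq> 0" "\<And>v. v \<in> V \<Longrightarrow> cinner v w = 0"
      using csubspace_orthogonal_exists[OF sub] by blast
    obtain w' c' where w': "w' \<noteq> 0"
      "\<And>z. norm z < 1 \<Longrightarrow> cinner (?\<sigma> z) w = 0 \<Longrightarrow> cinner z w' = c'"
      using ball_refl_image_in_subspace_imp_hyperplane[OF c w(1)] by blast
    have "cinner (f z) w' = c'" if z: "norm z < 1" for z
    proof (rule w'(2)[OF fball[OF z]])
      have "?\<sigma> (f z) \<in> V"
        using fixed_iff[OF ball_refl_in_ball[OF c fball[OF z]]] F_fix[OF z] by (simp add: V_def)
      then show "cinner (?\<sigma> (f z)) w = 0" by (rule w(2))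
    qed
    then have "\<exists>w c. w \<noteq> 0 \<and> (\<forall>z\<in>unit_ball. cinner (f z) w = c)"
      using w'(1) by (intro exI[of _ w'] exI[of _ c']) simp
    with min show False unfolding minimal_map_iff_no_hyperplane by (rule notE)
  qed
  have "\<psi> z = z" if z: "norm z < 1" for z
  proof -
    have \<sigma>z: "norm (?\<sigma> z) < 1" by (rule ball_refl_in_ball[OF c z])
    then have "F (?\<sigma> z) = ?\<sigma> z" using fixed_iff[OF \<sigma>z] \<open>V = UNIV\<close> by (auto simp: V_def)
    then have "?\<sigma> (\<psi> z) = ?\<sigma> z" by (simp add: F_def inv z)
    then have "?\<sigma> (?\<sigma> (\<psi> z)) = ?\<sigma> (?\<sigma> z)" by simp
    moreover have "norm (\<psi> z) < 1" using funcset_mem[OF self, of z] z by simp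
    ultimately show ?thesis by (simp add: inv z)
  qed
  moreover have "\<psi> \<in> extensional unit_ball" using bij by (simp add: Bij_def)
  ultimately show ?thesis by (intro extensionalityI[of _ unit_ball]) auto
qed

theorem proposition3p1:
  fixes f :: "complex ^ 'n \<Rightarrow> complex ^ 'N"
  assumes "f cholomorphic_on unit_ball"
    and "f \<in> unit_ball \<rightarrow> unit_ball"
  shows "trivial_group (H_group f) \<longleftrightarrow> minimal_map f"
proof -
  define e where "e = (\<lambda>z\<in>unit_ball. z :: complex ^ 'N)"
  have grp: "group (H_group f)"
    unfolding H_group_def
    by (rule group.subgroup_imp_group[OF group_Aut_ball_group subgroup_H[OF assms(2)]])
  have carrier: "carrier (H_group f) = H_set f" by (simp add: H_group_def)
  have one: "\<one>\<^bsub>H_group f\<^esub> = e"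
    by (simp add: H_group_def Aut_ball_group_def BijGroup_def e_def)
  have "e \<in> H_set f"
    using monoid.one_closed[OF group.is_monoid[OF grp]] unfolding carrier one .
  then have triv: "trivial_group (H_group f) \<longleftrightarrow> (\<forall>\<psi>\<in>H_set f. \<psi> = e)"
    using grp unfolding trivial_group_def carrier one by blast
  show ?thesis
  proof
    assume "trivial_group (H_group f)"
    then have all: "\<forall>\<psi>\<in>H_set f. \<psi> = e" by (rule triv[THEN iffD1])
    show "minimal_map f"
    proof (rule ccontr)
      assume "\<not> minimal_map f"
      from nontrivial_isotropy_if_not_minimal[OF assms(2) this]
      obtain \<psi> where "\<psi> \<in> H_set f" "\<psi> \<noteq> e" unfolding e_def .
      with all show False by blast
    qed
  next
    assume "minimal_map f"
    then have "\<forall>\<psi>\<in>H_set f. \<psi> = e"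
      unfolding e_def by (intro ballI isotropy_trivial_if_minimal[OF assms(2)])
    then show "trivial_group (H_group f)" by (rule triv[THEN iffD2])
  qed
qed

end
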